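(* Let $G$ be a graph with $Z_{\mathrm{SAP}}(G)=0$. Then every matrix in $\mathcal{S}(G)$ has the Strong Arnold Property. Therefore, $M(G)=\xi(G)$, $M_+(G)=\nu(G)$, and $M_\mu(G)=\mu(G)$.
   Context: Graphs are finite, simple and undirected; $\overline{G}$ is the complement of $G$, and a non-edge of $G$ is an edge of $\overline{G}$. $N_G(i)$ is the neighborhood of $i$ and $N_G[i]=N_G(i)\cup\{i\}$. Matrices. $\mathcal{S}(G)$ is the set of real symmetric matrices indexed by $V(G)$ whose $i,j$-entry, $i\neq j$, is nonzero if $i$ and $j$ are adjacent in $G$ and zero otherwise (diagonal entries are arbitrary real numbers). $\mathcal{S}_+(G)$ is the set of positive semidefinite matrices in $\mathcal{S}(G)$. A symmetric matrix $A$ has the Strong Arnold Property (SAP) if $X=O$ is the only real symmetric matrix with $A\circ X=O$, $I\circ X=O$ and $AX=O$, where $\circ$ is the entrywise product. Let $\mathrm{null}(A)$ denote the nullity of $A$. Define $M(G)=\max\{\mathrm{null}(A):A\in\mathcal{S}(G)\}$, $M_+(G)=\max\{\mathrm{null}(A):A\in\mathcal{S}_+(G)\}$, $\xi(G)=\max\{\mathrm{null}(A):A\in\mathcal{S}(G),\ A\text{ has the SAP}\}$, $\nu(G)=\max\{\mathrm{null}(A):A\in\mathcal{S}_+(G),\ A\text{ has the SAP}\}$. $M_\mu(G)$ is the maximum nullity of matrices $A\in\mathcal{S}(G)$ such that all off-diagonal entries of $A$ are non-positive and $A$ has exactly one negative eigenvalue (counting multiplicity); $\mu(G)$ is the maximum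 nullity over those matrices in this same family that in addition have the SAP. SAP zero forcing. At every stage each non-edge of $G$ is blue or white. Let $B_E$ be the current set of blue non-edges. For a vertex $k$, let $N_{B_E}(k)=\{j:\{j,k\}\in B_E\}$. The local game at $k$ is the zero forcing game on $G$ in which the blue vertices are $\phi_k(G,B_E)=N_G[k]\cup N_{B_E}(k)$ and all other vertices are white; $i\rightarrow j$ in the local game at $k$ means that $i$ is blue, and $j$ is the only white neighbor of $i$ in $G$. The color change rule for $Z_{\mathrm{SAP}}$ consists of: (1) (forcing triple) if $\{j,k\}$ is a white non-edge and $i\rightarrow j$ in the local game at $k$ for some vertex $i$, then $\{j,k\}$ turns blue; this is denoted $(k:i\rightarrow j)$; (2) (odd cycle rule) let $\overline{G}_W$ be the graph on $V(G)$ whose edges are the white non-edges; if for some vertex $i$ the induced subgraph $\overline{G}_W[N_G(i)]$ has a connected component that is an odd cycle $C$, then all non-edges on $C$ turn blue. $Z_{\mathrm{SAP}}(G)$ is the minimum number of non-edges in an initial blue set such that every non-edge becomes blue by repeated applications of this rule. *)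

theory Defs
  imports "HOL-Analysis.Analysis" "HOL-Computational_Algebra.Polynomial"
begin

text \<open>A graph is given by its adjacency relation; its vertex set is the whole (finite) index type,
  so that matrices indexed by the vertices have type \<^typ>\<open>real^'n^'n\<close>.\<close>

definition simple_graph :: "('n::finite \<Rightarrow> 'n \<Rightarrow> bool) \<Rightarrow> bool" where
  "simple_graph G \<longleftrightarrow> symp G \<and> irreflp G"

definition nbhd :: "('n \<Rightarrow> 'n \<Rightarrow> bool) \<Rightarrow> 'n \<Rightarrow> 'n set" where
  "nbhd G i = {j. G i j}"

definition closed_nbhd :: "('n \<Rightarrow> 'n \<Rightarrow> bool) \<Rightarrow> 'n \<Rightarrow> 'n set" where
  "closed_nbhd G i = nbhd G i \<union> {i}"

definition non_edges :: "('n \<Rightarrow> 'n \<Rightarrow> bool) \<Rightarrow> 'n set set" where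
  "non_edges G = {{i, j} | i j. i \<noteq> j \<and> \<not> G i j}"


subsection \<open>Matrices of a graph\<close>

definition symmetric_mat :: "real^'n^'n \<Rightarrow> bool" where
  "symmetric_mat A \<longleftrightarrow> transpose A = A"

definition psd_mat :: "real^'n::finite^'n \<Rightarrow> bool" where
  "psd_mat A \<longleftrightarrow> symmetric_mat A \<and> (\<forall>x. 0 \<le> x \<bullet> (A *v x))"

definition hadamard :: "real^'n^'m \<Rightarrow> real^'n^'m \<Rightarrow> real^'n^'m" where
  "hadamard A X = (\<chi> i j. A $ i $ j * X $ i $ j)"

definition SAP :: "real^'n::finite^'n \<Rightarrow> bool" where
  "SAP A \<longleftrightarrow> (\<forall>X. symmetric_mat X \<and> hadamard A X = 0 \<and> hadamard (mat 1) X = 0 \<and> A ** X = 0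
      \<longrightarrow> X = 0)"

definition nullity :: "real^'n::finite^'n \<Rightarrow> nat" where
  "nullity A = dim {x. A *v x = 0}"

text \<open>The characteristic polynomial $\det(tI - A)$.\<close>

definition charpoly :: "real^'n::finite^'n \<Rightarrow> real poly" where
  "charpoly A = det ((\<chi> i j. (if i = j then [:0, 1:] else 0) - [:A $ i $ j:]) :: real poly^'n^'n)"

definition num_neg_eigenvalues :: "real^'n::finite^'n \<Rightarrow> nat" where
  "num_neg_eigenvalues A = (\<Sum>l | l < 0 \<and> poly (charpoly A) l = 0. order l (charpoly A))"

definition graph_mats :: "('n::finite \<Rightarrow> 'n \<Rightarrow> bool) \<Rightarrow> (real^'n^'n) set" where
  "graph_mats G = {A. symmetric_mat A \<and> (\<forall>i j. i \<noteq> j \<longrightarrow> (A $ i $ j \<noteq> 0 \<longleftrightarrow> G i j))}"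

definition psd_graph_mats :: "('n::finite \<Rightarrow> 'n \<Rightarrow> bool) \<Rightarrow> (real^'n^'n) set" where
  "psd_graph_mats G = {A \<in> graph_mats G. psd_mat A}"

definition mu_graph_mats :: "('n::finite \<Rightarrow> 'n \<Rightarrow> bool) \<Rightarrow> (real^'n^'n) set" where
  "mu_graph_mats G = {A \<in> graph_mats G.
      (\<forall>i j. i \<noteq> j \<longrightarrow> A $ i $ j \<le> 0) \<and> num_neg_eigenvalues A = 1}"

text \<open>Since \<^const>\<open>Max\<close> is unspecified on empty and infinite sets: the nullities below are bounded
  by \<open>CARD('n)\<close>, and each of the six families contains an invertible matrix (take suitable
  diagonal entries of large modulus), which has the SAP.\<close>

definition max_nullity :: "('n::finite \<Rightarrow> 'n \<Rightarrow> bool) \<Rightarrow> nat" where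
  "max_nullity G = Max {nullity A | A. A \<in> graph_mats G}"

definition max_nullity_psd :: "('n::finite \<Rightarrow> 'n \<Rightarrow> bool) \<Rightarrow> nat" where
  "max_nullity_psd G = Max {nullity A | A. A \<in> psd_graph_mats G}"

definition max_nullity_mu :: "('n::finite \<Rightarrow> 'n \<Rightarrow> bool) \<Rightarrow> nat" where
  "max_nullity_mu G = Max {nullity A | A. A \<in> mu_graph_mats G}"

definition xi_param :: "('n::finite \<Rightarrow> 'n \<Rightarrow> bool) \<Rightarrow> nat" where
  "xi_param G = Max {nullity A | A. A \<in> graph_mats G \<and> SAP A}"

definition nu_param :: "('n::finite \<Rightarrow> 'n \<Rightarrow> bool) \<Rightarrow> nat" where
  "nu_param G = Max {nullity A | A. A \<in> psd_graph_mats G \<and> SAP A}"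

definition mu_param :: "('n::finite \<Rightarrow> 'n \<Rightarrow> bool) \<Rightarrow> nat" where
  "mu_param G = Max {nullity A | A. A \<in> mu_graph_mats G \<and> SAP A}"


subsection \<open>SAP zero forcing\<close>

text \<open>Throughout, \<open>B\<close> is the set of blue non-edges, each non-edge being a two-element vertex set.\<close>

definition phi :: "('n \<Rightarrow> 'n \<Rightarrow> bool) \<Rightarrow> 'n set set \<Rightarrow> 'n \<Rightarrow> 'n set" where
  "phi G B k = closed_nbhd G k \<union> {j. {j, k} \<in> B}"

text \<open>\<open>i \<rightarrow> j\<close> in the zero forcing game on \<open>G\<close> whose set of blue vertices is \<open>S\<close>.\<close>

definition zf_forces :: "('n \<Rightarrow> 'n \<Rightarrow> bool) \<Rightarrow> 'n set \<Rightarrow> 'n \<Rightarrow> 'n \<Rightarrow> bool" where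
  "zf_forces G S i j \<longleftrightarrow> i \<in> S \<and> nbhd G i - S = {j}"

definition white_graph :: "('n \<Rightarrow> 'n \<Rightarrow> bool) \<Rightarrow> 'n set set \<Rightarrow> 'n \<Rightarrow> 'n \<Rightarrow> bool" where
  "white_graph G B x y \<longleftrightarrow> {x, y} \<in> non_edges G - B"

definition induced :: "('n \<Rightarrow> 'n \<Rightarrow> bool) \<Rightarrow> 'n set \<Rightarrow> 'n \<Rightarrow> 'n \<Rightarrow> bool" where
  "induced H U x y \<longleftrightarrow> x \<in> U \<and> y \<in> U \<and> H x y"

text \<open>\<open>C\<close> is the vertex set of a connected component of the induced subgraph \<open>H[U]\<close>.\<close>

definition is_component :: "('n \<Rightarrow> 'n \<Rightarrow> bool) \<Rightarrow> 'n set \<Rightarrow> 'n set \<Rightarrow> bool" where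
  "is_component H U C \<longleftrightarrow> (\<exists>x\<in>U. C = {y. (induced H U)\<^sup>*\<^sup>* x y})"

text \<open>The subgraph of \<open>H\<close> induced on \<open>C\<close> is a cycle (so it has no chords) of odd length.\<close>

definition is_odd_cycle :: "('n \<Rightarrow> 'n \<Rightarrow> bool) \<Rightarrow> 'n set \<Rightarrow> bool" where
  "is_odd_cycle H C \<longleftrightarrow> (\<exists>vs. distinct vs \<and> set vs = C \<and> 3 \<le> length vs \<and> odd (length vs) \<and>
      (\<forall>a < length vs. \<forall>b < length vs.
         H (vs ! a) (vs ! b) \<longleftrightarrow> b = Suc a mod length vs \<or> a = Suc b mod length vs))"

inductive sap_step :: "('n \<Rightarrow> 'n \<Rightarrow> bool) \<Rightarrow> 'n set set \<Rightarrow> 'n set set \<Rightarrow> bool"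
  for G :: "'n \<Rightarrow> 'n \<Rightarrow> bool" where
  forcing_triple:
    "{j, k} \<in> non_edges G - B \<Longrightarrow> zf_forces G (phi G B k) i j \<Longrightarrow>
     sap_step G B (insert {j, k} B)"
| odd_cycle:
    "is_component (white_graph G B) (nbhd G i) C \<Longrightarrow> is_odd_cycle (white_graph G B) C \<Longrightarrow>
     sap_step G B (B \<union> {{x, y} | x y. x \<in> C \<and> y \<in> C \<and> white_graph G B x y})"

definition Z_SAP :: "('n::finite \<Rightarrow> 'n \<Rightarrow> bool) \<Rightarrow> nat" where
  "Z_SAP G = (LEAST m. \<exists>B. B \<subseteq> non_edges G \<and> card B = m \<and> (sap_step G)\<^sup>*\<^sup>* B (non_edges G))"

end

theory Submission
  imports Defs
begin

text \<open>Let \<open>X\<close> be a symmetric matrix with \<open>A \<circ> X = I \<circ> X = A X = 0\<close>. Reading a blue non-edge as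
  an entry of \<open>X\<close> known to vanish, each colour change is a consequence of \<open>A X = 0\<close>. For a forcing
  triple \<open>(k : i \<rightarrow> j)\<close>, the entry \<open>(i, k)\<close> of \<open>A X\<close> reduces to the single term
  \<open>a\<^bsub>ij\<^esub> x\<^bsub>jk\<^esub>\<close>. For an odd cycle in the neighbourhood of \<open>i\<close>, the entries \<open>(i, k)\<close> with \<open>k\<close> on
  the cycle say that the numbers \<open>a\<^bsub>iu\<^esub> a\<^bsub>iv\<^esub> x\<^bsub>uv\<^esub>\<close> change sign from each cycle edge \<open>uv\<close> to the
  next, so that they vanish because the length is odd. If no initial blue non-edge is needed, then
  \<open>X = 0\<close>.\<close>

section \<open>Graphs, components and cyclic sequences\<close>

lemma simple_graphD:
  assumes "simple_graph G"
  shows "G x y \<Longrightarrow> G y x" and "\<not> G x x"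
  using assms by (auto simp: simple_graph_def dest: sympD irreflpD)

lemma doubleton_in_non_edges_iff:
  assumes "simple_graph G"
  shows "{x, y} \<in> non_edges G \<longleftrightarrow> x \<noteq> y \<and> \<not> G x y"
  using simple_graphD[OF assms] by (auto simp: non_edges_def doubleton_eq_iff)

lemma is_component_subset: "is_component H U C \<Longrightarrow> C \<subseteq> U"
  by (auto simp: is_component_def induced_def elim: rtranclp.cases)

lemma is_component_closed:
  assumes "is_component H U C" "x \<in> C" "y \<in> U" "H x y"
  shows "y \<in> C"
proof -
  from assms(1) obtain z where C: "C = {y. (induced H U)\<^sup>*\<^sup>* z y}"
    by (auto simp: is_component_def)
  have "induced H U x y"
    using is_component_subset[OF assms(1)] assms by (auto simp: induced_def)
  then show ?thesis
    using C \<open>x \<in> C\<close> by (auto intro: rtranclp.rtrancl_into_rtrancl)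
qed

lemma Suc_mod_inject:
  assumes "a < n" "b < n" "Suc a mod n = Suc b mod n"
  shows "a = b"
  using assms by (auto simp: mod_Suc split: if_splits)

text \<open>Iteration gives \<open>y (b mod n) = (-1) ^ b * y 0\<close>; at \<open>b = n\<close> the
  index is back at 0 with sign -1.\<close>

lemma odd_cyclic_alternating_zero:
  fixes y :: "nat \<Rightarrow> real"
  assumes "odd n" and alt: "\<And>a. a < n \<Longrightarrow> y a + y (Suc a mod n) = 0" and "a < n"
  shows "y a = 0"
proof -
  have "0 < n" using \<open>a < n\<close> by simp
  have pow: "y (b mod n) = (-1) ^ b * y 0" for b
  proof (induction b)
    case (Suc b)
    have "y (b mod n) + y (Suc b mod n) = 0"
      using alt[of "b mod n"] \<open>0 < n\<close> by (simp add: mod_Suc_eq)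
    with Suc show ?case by simp
  qed simp
  from pow[of n] \<open>odd n\<close> have "y 0 = 0" by simp
  with pow[of a] \<open>a < n\<close> show ?thesis by simp
qed

section \<open>Vanishing of a test matrix under the colour changes\<close>

locale sap_test_matrix =
  fixes G :: "'n::finite \<Rightarrow> 'n \<Rightarrow> bool" and A X :: "real^'n^'n"
  assumes simple: "simple_graph G"
    and A_graph: "A \<in> graph_mats G"
    and X_symmetric: "symmetric_mat X"
    and AX_hadamard: "hadamard A X = 0"
    and IX_hadamard: "hadamard (mat 1) X = 0"
    and AX_zero: "A ** X = 0"
begin

text \<open>The invariant of the game: it is trivial for the empty set, and every step preserves
  it.\<close>

definition vanishes_on :: "'n set set \<Rightarrow> bool" where
  "vanishes_on B \<longleftrightarrow> (\<forall>j k. {j, k} \<in> B \<longrightarrow> X $ j $ k = 0)"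

lemma X_commute: "X $ j $ k = X $ k $ j"
proof -
  have "transpose X $ k $ j = X $ k $ j" using X_symmetric by (simp add: symmetric_mat_def)
  then show ?thesis by (simp add: transpose_def)
qed

lemma X_diagonal: "X $ j $ j = 0"
proof -
  have "hadamard (mat 1) X $ j $ j = 0" by (simp add: IX_hadamard)
  then show ?thesis by (simp add: hadamard_def mat_def)
qed

lemma A_nonzero_iff: "j \<noteq> k \<Longrightarrow> A $ j $ k \<noteq> 0 \<longleftrightarrow> G j k"
  using A_graph by (auto simp: graph_mats_def)

lemma X_edge:
  assumes "G j k"
  shows "X $ j $ k = 0"
proof -
  have "hadamard A X $ j $ k = 0" by (simp add: AX_hadamard)
  then have "A $ j $ k * X $ j $ k = 0" by (simp add: hadamard_def)
  moreover have "j \<noteq> k" using assms simple_graphD(2)[OF simple] by auto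
  ultimately show ?thesis using A_nonzero_iff assms by auto
qed

lemma AX_entry: "(\<Sum>l\<in>UNIV. A $ i $ l * X $ l $ k) = 0"
proof -
  have "(A ** X) $ i $ k = 0" by (simp add: AX_zero)
  then show ?thesis by (simp add: matrix_matrix_mult_def)
qed

text \<open>Two vertices are equal, adjacent, or joined by a blue or a white non-edge;
  \<open>X\<close> vanishes in the first three cases.\<close>

lemma X_zero_or_white:
  assumes "vanishes_on B"
  shows "X $ x $ y = 0 \<or> white_graph G B x y"
  using assms X_diagonal X_edge
  by (auto simp: vanishes_on_def white_graph_def doubleton_in_non_edges_iff[OF simple])

lemma vanishes_on_phi:
  assumes "vanishes_on B" "l \<in> phi G B k"
  shows "X $ l $ k = 0"
  using assms X_diagonal X_edge[of k l] X_commute[of l k]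
  by (auto simp: vanishes_on_def phi_def closed_nbhd_def nbhd_def)

lemma forcing_triple_zero:
  assumes B: "vanishes_on B" and force: "zf_forces G (phi G B k) i j"
  shows "X $ j $ k = 0"
proof -
  have i: "i \<in> phi G B k" and N: "nbhd G i - phi G B k = {j}"
    using force by (auto simp: zf_forces_def)
  have "(\<Sum>l\<in>UNIV. A $ i $ l * X $ l $ k) = (\<Sum>l\<in>{j}. A $ i $ l * X $ l $ k)"
  proof (rule sum.mono_neutral_right)
    show "\<forall>l\<in>UNIV - {j}. A $ i $ l * X $ l $ k = 0"
    proof
      fix l assume l: "l \<in> UNIV - {j}"
      show "A $ i $ l * X $ l $ k = 0"
      proof (cases "l \<in> phi G B k")
        case True
        then show ?thesis using vanishes_on_phi[OF B] by simp
      next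
        case False
        \<comment> \<open>The white \<open>l\<close> differs from the blue \<open>i\<close>, which
          keeps out the arbitrary diagonal entry \<open>A $ i $ i\<close>.\<close>
        with l N i have "\<not> G i l" "i \<noteq> l" by (auto simp: nbhd_def)
        then show ?thesis using A_nonzero_iff by auto
      qed
    qed
  qed auto
  with AX_entry[of i k] have "A $ i $ j * X $ j $ k = 0" by simp
  moreover have "G i j" using N by (auto simp: nbhd_def)
  moreover have "i \<noteq> j" using i N by auto
  ultimately show ?thesis using A_nonzero_iff by auto
qed

lemma odd_cycle_zero:
  assumes B: "vanishes_on B"
    and comp: "is_component (white_graph G B) (nbhd G i) C"
    and cyc: "is_odd_cycle (white_graph G B) C"
    and xy: "x \<in> C" "z \<in> C"
  shows "X $ x $ z = 0"
proof -
  obtain vs where vs: "distinct vs" "set vs = C" "3 \<le> length vs" "odd (length vs)"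
    and adj: "\<And>a b. a < length vs \<Longrightarrow> b < length vs \<Longrightarrow>
         white_graph G B (vs ! a) (vs ! b) \<longleftrightarrow> b = Suc a mod length vs \<or> a = Suc b mod length vs"
    using cyc unfolding is_odd_cycle_def by blast
  define n where "n = length vs"
  define nx where "nx a = Suc a mod n" for a
  have "0 < n" using vs(3) unfolding n_def by linarith
  then have nx: "nx a < n" for a by (simp add: nx_def)
  have C_nbhd: "G i (vs ! a)" if "a < n" for a
  proof -
    have "vs ! a \<in> C" using that vs(2) unfolding n_def by auto
    then show ?thesis using is_component_subset[OF comp] by (auto simp: nbhd_def)
  qed
  have A_cycle: "A $ i $ (vs ! a) \<noteq> 0" if "a < n" for a
  proof -
    have "G i (vs ! a)" using C_nbhd that .
    moreover from this have "i \<noteq> vs ! a" using simple_graphD(2)[OF simple] by metis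
    ultimately show ?thesis using A_nonzero_iff by simp
  qed
  \<comment> \<open>The equation for a cycle vertex weights each of its two cycle edges by the entry
    of \<open>A\<close> at the far end. Multiplying by the entry at the vertex itself makes both
    terms values of one function of edges.\<close>
  define y where "y a = A $ i $ (vs ! a) * A $ i $ (vs ! nx a) * X $ (vs ! a) $ (vs ! nx a)" for a
  have alt: "y a + y (Suc a mod n) = 0" if a: "a < n" for a
  proof -
    define b where "b = nx a"
    define c where "c = nx b"
    have lt: "b < n" "c < n" using nx by (auto simp: b_def c_def)
    \<comment> \<open>Length at least 3 makes the two cycle neighbours of \<open>vs ! b\<close>
      distinct, so the reduced sum has two terms.\<close>
    have "a \<noteq> c"
      using vs(3) a by (auto simp: b_def c_def nx_def n_def mod_Suc split: if_splits)
    then have ne: "vs ! a \<noteq> vs ! c"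
      using a lt vs(1) by (simp add: n_def nth_eq_iff_index_eq)
    have "(\<Sum>l\<in>UNIV. A $ i $ l * X $ l $ (vs ! b)) =
          (\<Sum>l\<in>{vs ! a, vs ! c}. A $ i $ l * X $ l $ (vs ! b))"
    proof (rule sum.mono_neutral_right)
      show "\<forall>l\<in>UNIV - {vs ! a, vs ! c}. A $ i $ l * X $ l $ (vs ! b) = 0"
      proof (intro ballI, rule ccontr)
        fix l assume l: "l \<in> UNIV - {vs ! a, vs ! c}"
          and nz: "A $ i $ l * X $ l $ (vs ! b) \<noteq> 0"
        \<comment> \<open>The diagonal entry \<open>A $ i $ i\<close> is harmless: \<open>i\<close>
          is adjacent to \<open>vs ! b\<close>, so \<open>X $ i $ (vs ! b) = 0\<close>.\<close>
        have "l \<noteq> i" using nz X_edge[OF C_nbhd[OF lt(1)]] by auto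
        then have "G i l" using nz A_nonzero_iff[of i l] by auto
        have white: "white_graph G B l (vs ! b)" using nz X_zero_or_white[OF B] by auto
        then have "white_graph G B (vs ! b) l" by (simp add: white_graph_def insert_commute)
        \<comment> \<open>A white neighbour of \<open>vs ! b\<close> inside \<open>nbhd G i\<close>
          cannot leave the component; the absence of chords then makes it \<open>vs ! a\<close> or
          \<open>vs ! c\<close>.\<close>
        then have "l \<in> C"
          using is_component_closed[OF comp, of "vs ! b" l] lt vs(2) \<open>G i l\<close>
          by (auto simp: n_def nbhd_def)
        then obtain d where d: "d < n" "l = vs ! d"
          using vs(2) by (metis in_set_conv_nth n_def)
        from white adj[of d b] d lt have "b = nx d \<or> d = c"
          by (simp add: n_def nx_def c_def)
        then have "d = a \<or> d = c"
          using Suc_mod_inject[of d n a] d a by (auto simp: b_def nx_def)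
        with d l show False by auto
      qed
    qed auto
    with AX_entry[of i "vs ! b"] ne
    have "A $ i $ (vs ! a) * X $ (vs ! a) $ (vs ! b) +
          A $ i $ (vs ! c) * X $ (vs ! c) $ (vs ! b) = 0" by simp
    then have "A $ i $ (vs ! b) * (A $ i $ (vs ! a) * X $ (vs ! a) $ (vs ! b) +
          A $ i $ (vs ! c) * X $ (vs ! c) $ (vs ! b)) = 0" by simp
    moreover have "y a + y b = A $ i $ (vs ! b) * (A $ i $ (vs ! a) * X $ (vs ! a) $ (vs ! b) +
          A $ i $ (vs ! c) * X $ (vs ! c) $ (vs ! b))"
      using X_commute[of "vs ! b" "vs ! c"]
      by (simp add: y_def b_def[symmetric] c_def[symmetric] algebra_simps)
    ultimately show ?thesis by (simp add: b_def nx_def)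
  qed
  have "y a = 0" if "a < n" for a
    using odd_cyclic_alternating_zero[of n y a] alt that vs(4) by (simp add: n_def)
  then have cycle_edge: "X $ (vs ! a) $ (vs ! nx a) = 0" if "a < n" for a
    using that A_cycle nx by (auto simp: y_def)
  obtain a b where ab: "a < n" "x = vs ! a" "b < n" "z = vs ! b"
    using xy vs(2) by (metis in_set_conv_nth n_def)
  \<comment> \<open>Non-consecutive vertices of the cycle are not joined in the white graph, so
    their entries vanish already.\<close>
  show ?thesis
  proof (cases "white_graph G B x z")
    case True
    then have "b = nx a \<or> a = nx b" using adj[of a b] ab by (simp add: n_def nx_def)
    then show ?thesis using cycle_edge[of a] cycle_edge[of b] ab X_commute by metis
  next
    case False
    then show ?thesis using X_zero_or_white[OF B] by blast
  qed
qed

lemma sap_step_vanishes: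
  assumes "sap_step G B B'" "vanishes_on B"
  shows "vanishes_on B'"
  using assms(1)
proof cases
  case (forcing_triple j k i)
  have "X $ j $ k = 0" using assms(2) forcing_triple(3) by (rule forcing_triple_zero)
  \<comment> \<open>The invariant speaks of ordered pairs, so one non-edge stands for two
    entries.\<close>
  moreover from this have "X $ k $ j = 0" by (simp add: X_commute[of k j])
  ultimately show ?thesis
    using assms(2) unfolding forcing_triple(1) vanishes_on_def by (auto simp: doubleton_eq_iff)
next
  case (odd_cycle i C)
  have "X $ x $ y = 0" if "x \<in> C" "y \<in> C" for x y
    using assms(2) odd_cycle(2,3) that by (rule odd_cycle_zero)
  then show ?thesis
    using assms(2) unfolding odd_cycle(1) vanishes_on_def by (auto simp: doubleton_eq_iff)
qed

lemma sap_steps_vanishes: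
  assumes "(sap_step G)\<^sup>*\<^sup>* B B'" "vanishes_on B"
  shows "vanishes_on B'"
  using assms(1)
proof induction
  case base
  show ?case by fact
next
  case (step C D)
  from step.hyps(2) step.IH show ?case by (rule sap_step_vanishes)
qed

lemma X_zero_if_forced:
  assumes "(sap_step G)\<^sup>*\<^sup>* {} (non_edges G)"
  shows "X = 0"
proof -
  have "vanishes_on {}" by (simp add: vanishes_on_def)
  with assms have "vanishes_on (non_edges G)" by (rule sap_steps_vanishes)
  \<comment> \<open>With all non-edges blue, the white graph has no edges.\<close>
  then have "X $ j $ k = 0" for j k
    using X_zero_or_white[of "non_edges G" j k] by (simp add: white_graph_def)
  then show ?thesis by (simp add: vec_eq_iff)
qed

end

section \<open>Strong Arnold property from a vanishing forcing number\<close>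

lemma Z_SAP_attained:
  "\<exists>B\<subseteq>non_edges G. card B = Z_SAP G \<and> (sap_step G)\<^sup>*\<^sup>* B (non_edges G)"
proof -
  let ?P = "\<lambda>m. \<exists>B. B \<subseteq> non_edges G \<and> card B = m \<and> (sap_step G)\<^sup>*\<^sup>* B (non_edges G)"
  \<comment> \<open>Colouring all non-edges at the start takes no steps, so \<open>LEAST\<close>
    ranges over a nonempty set.\<close>
  have "?P (card (non_edges G))" by blast
  then have "?P (LEAST m. ?P m)" by (rule LeastI)
  then show ?thesis by (simp add: Z_SAP_def)
qed

lemma SAP_if_Z_SAP_0:
  assumes "simple_graph G" "Z_SAP G = 0" "A \<in> graph_mats G"
  shows "SAP A"
  unfolding SAP_def
proof (intro allI impI, elim conjE)
  fix X
  assume X: "symmetric_mat X" "hadamard A X = 0" "hadamard (mat 1) X = 0" "A ** X = 0"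
  then interpret sap_test_matrix G A X
    using assms by unfold_locales
  \<comment> \<open>The vertex type is finite, so cardinality 0 leaves only the empty initial
    set.\<close>
  have "(sap_step G)\<^sup>*\<^sup>* {} (non_edges G)"
    using Z_SAP_attained[of G] assms(2) by auto
  then show "X = 0" by (rule X_zero_if_forced)
qed

theorem theorem2p6:
  fixes G :: "'n::finite \<Rightarrow> 'n \<Rightarrow> bool"
  assumes "simple_graph G" and "Z_SAP G = 0"
  shows "(\<forall>A \<in> graph_mats G. SAP A) \<and>
         max_nullity G = xi_param G \<and>
         max_nullity_psd G = nu_param G \<and>
         max_nullity_mu G = mu_param G"
proof -
  have sap: "SAP A" if "A \<in> graph_mats G" for A
    using SAP_if_Z_SAP_0 assms that by blast
  \<comment> \<open>All three families lie in \<open>graph_mats G\<close>, so requiring SAP removes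
    nothing and the paired maxima are over equal sets.\<close>
  then have "A \<in> graph_mats G \<and> SAP A \<longleftrightarrow> A \<in> graph_mats G"
    "A \<in> psd_graph_mats G \<and> SAP A \<longleftrightarrow> A \<in> psd_graph_mats G"
    "A \<in> mu_graph_mats G \<and> SAP A \<longleftrightarrow> A \<in> mu_graph_mats G" for A
    by (auto simp: psd_graph_mats_def mu_graph_mats_def)
  with sap show ?thesis
    by (simp add: max_nullity_def xi_param_def max_nullity_psd_def nu_param_def
        max_nullity_mu_def mu_param_def)
qed

end
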